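(* Let $\alpha$ be a real number with $0\le\alpha\le 1$. Then there exists a set $A=\{a_i : i\in\mathbb{N}\}\subseteq\mathbb{N}$ with $a_i<a_{i+1}$ for all $i\in\mathbb{N}$, $d(A)=\alpha$ and $\liminf_{n\to\infty}\frac{a_{n+1}}{a_n}=1$, such that there is no additive complement of $A$ in the complement of $A$.
   Context: $\mathbb{N}=\{1,2,3,\dots\}$ is the set of natural numbers. For $A,B\subseteq\mathbb{N}$, $A+B:=\{x+y: x\in A,\ y\in B\}$. A set $B\subseteq\mathbb{N}$ is an additive complement of $A\subseteq\mathbb{N}$ if $\mathbb{N}\setminus(A+B)$ is a finite set. A set $B\subseteq\mathbb{N}$ is an additive complement of $A$ in the complement of $A$ if $B$ is an additive complement of $A$ and $B\cap A=\varnothing$. The density of $A\subseteq\mathbb{N}$ is $d(A)=\lim_{n\to\infty}\frac{|A\cap\{1,\dots,n\}|}{n}$ when this limit exists (i.e. when the corresponding limsup and liminf coincide); the equation $d(A)=\alpha$ includes the assertion that the limit exists. *)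

theory Defs
  imports Complex_Main "HOL-Library.Set_Algebras" "HOL-Library.Extended_Real"
begin

text \<open>
  The natural numbers start at 1 here: they are the set \<^term>\<open>{1..} :: nat set\<close>,
  and sets of natural numbers are its subsets. The sumset \<^term>\<open>A + B\<close> is the
  elementwise sum of \<^theory>\<open>HOL-Library.Set_Algebras\<close>.
\<close>

definition additive_complement :: "nat set \<Rightarrow> nat set \<Rightarrow> bool" where
  "additive_complement A B \<longleftrightarrow> B \<subseteq> {1..} \<and> finite ({1..} - (A + B))"

definition additive_complement_in_complement :: "nat set \<Rightarrow> nat set \<Rightarrow> bool" where
  "additive_complement_in_complement A B \<longleftrightarrow> additive_complement A B \<and> B \<inter> A = {}"

text \<open>
  The equation \<open>d(A) = \<alpha>\<close> is a relation because it includes the existence of the limit.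
\<close>

definition has_density :: "nat set \<Rightarrow> real \<Rightarrow> bool" where
  "has_density A \<alpha> \<longleftrightarrow> (\<lambda>n. real (card (A \<inter> {1..n})) / real n) \<longlonglongrightarrow> \<alpha>"

end

theory Submission
  imports Defs "HOL-Library.Infinite_Set" "HOL-Real_Asymp.Real_Asymp"
begin

text \<open>
  If \<open>A \<inter> {1..<n}\<close> is invariant under \<open>x \<mapsto> n - x\<close>, then \<open>n \<notin> A + B\<close> for every \<open>B\<close> disjoint
  from \<open>A\<close>. So it suffices to find sets of density \<open>\<alpha>\<close> with this symmetry for infinitely many \<open>n\<close>.
  For \<open>\<alpha> > 0\<close> membership of \<open>x\<close> is decided by the binary digit of \<open>\<alpha>\<close> whose position is the
  2-adic valuation of \<open>x\<close>, which is symmetric for every \<open>n = 2 ^ k\<close>. For \<open>\<alpha> = 0\<close> that set is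
  empty, and one instead closes \<open>{1, 2}\<close> under reflections about the rapidly growing \<open>n = 3 * 4 ^ k\<close>.
\<close>

section \<open>Reflection symmetry\<close>

text \<open>If n = x + y with x in \<open>A\<close> and y in \<open>B\<close>, then y >= 1 puts x
  below n, so y = n - x lies in \<open>A\<close>, against disjointness. Every such n is missed by
  \<open>A + B\<close>, and these n are unbounded.\<close>

lemma no_complement_in_complement:
  assumes sym: "\<And>m. \<exists>n\<ge>m. \<forall>x\<in>A. x < n \<longrightarrow> n - x \<in> A"
  shows "\<not> additive_complement_in_complement A B"
proof
  assume "additive_complement_in_complement A B"
  then have B: "B \<subseteq> {1..}" and fin: "finite ({1..} - (A + B))" and disj: "B \<inter> A = {}"
    by (auto simp: additive_complement_in_complement_def additive_complement_def)
  from fin obtain m where m: "\<And>n. n \<in> {1..} - (A + B) \<Longrightarrow> n \<le> m"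
    unfolding finite_nat_set_iff_bounded_le by auto
  obtain n where n: "n \<ge> Suc m" "\<forall>x\<in>A. x < n \<longrightarrow> n - x \<in> A"
    using sym[of "Suc m"] by blast
  have "\<not> n \<le> m" "n \<in> {1..}" using n(1) by auto
  then have "n \<in> A + B" using m[of n] by blast
  then obtain x y where xy: "x \<in> A" "y \<in> B" "n = x + y"
    by (auto elim: set_plus_elim)
  then have "y > 0" using B by auto
  then have "y \<in> A" using n(2) xy by (metis add_diff_cancel_left' less_add_same_cancel1)
  then show False using xy disj by auto
qed

text \<open>Gaps of at most \<open>c\<close> after arbitrarily large x give ratios at most 1 + c/x,
  while monotonicity keeps every ratio at least 1. \<open>enumerate\<close> counts from 0 and
  \<open>a\<close> from 1; truncated subtraction makes \<open>a 0 = a 1\<close>, so the ratio at n =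
  0 is 1.\<close>

lemma liminf_ratio_enumerate:
  fixes A :: "nat set"
  assumes pos: "A \<subseteq> {1..}" and inf: "infinite A"
    and gap: "\<And>m. \<exists>x\<ge>m. x \<in> A \<and> (\<exists>y\<in>A. x < y \<and> y \<le> x + c)"
  defines "a \<equiv> \<lambda>i. enumerate A (i - 1)"
  shows "liminf (\<lambda>n. ereal (real (a (n + 1)) / real (a n))) = 1"
proof (rule antisym)
  have apos: "a i \<ge> 1" for i
    using enumerate_in_set[OF inf] pos by (auto simp: a_def)
  have "real (a (n + 1)) / real (a n) \<ge> 1" for n
    using apos[of n] enumerate_mono_le_iff[OF inf, of "n - 1" n]
    by (auto simp: a_def)
  then show "1 \<le> liminf (\<lambda>n. ereal (real (a (n + 1)) / real (a n)))"
    by (intro Liminf_bounded always_eventually) auto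
  show "liminf (\<lambda>n. ereal (real (a (n + 1)) / real (a n))) \<le> 1"
  proof (rule ccontr)
    assume "\<not> ?thesis"
    then have "1 < liminf (\<lambda>n. ereal (real (a (n + 1)) / real (a n)))" by simp
    then obtain y where y: "1 < ereal y" "ereal y < liminf (\<lambda>n. ereal (real (a (n + 1)) / real (a n)))"
      using ereal_dense2 by blast
    then obtain N where N: "\<And>n. n \<ge> N \<Longrightarrow> y < real (a (n + 1)) / real (a n)"
      using less_LiminfD[OF y(2)] by (auto simp: eventually_sequentially)
    have y1: "y > 1" using y(1) by simp
    \<comment> \<open>The first bound puts the index of x at or past \<open>N\<close>; the second
      gives c <= (y - 1) * x, that is, 1 + c/x <= y.\<close>
    obtain x z where x: "x \<ge> max (enumerate A N) (nat \<lceil>c / (y - 1)\<rceil>)" "x \<in> A"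
      and z: "z \<in> A" "x < z" "z \<le> x + c"
      using gap[of "max (enumerate A N) (nat \<lceil>c / (y - 1)\<rceil>)"] by blast
    obtain i where i: "x = enumerate A i" using x(2) enumerate_Ex[OF inf] by metis
    obtain j where j: "z = enumerate A j" using z(1) enumerate_Ex[OF inf] by metis
    have "i \<ge> N" using x(1) i enumerate_mono_le_iff[OF inf] by auto
    have "Suc i \<le> j" using z(2) i j enumerate_mono_iff[OF inf] by auto
    then have "enumerate A (Suc i) \<le> x + c"
      using z(3) j enumerate_mono_le_iff[OF inf, of "Suc i" j] by linarith
    moreover have "y < enumerate A (Suc i) / x"
      using N[of "Suc i"] \<open>i \<ge> N\<close> i by (simp add: a_def)
    moreover have "x \<ge> 1" using x(2) pos by auto
    ultimately have "y * x < real x + c"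
      by (simp add: field_simps)
    moreover have "c / (y - 1) \<le> x" using x(1) by linarith
    ultimately show False using y1 by (simp add: field_simps)
  qed
qed

text \<open>Common end of both density cases: what remains is to supply a symmetric set of the right
  density with bounded gaps arbitrarily far out.\<close>

lemma sequence_without_complement:
  fixes A :: "nat set"
  assumes pos: "A \<subseteq> {1..}" and dens: "has_density A \<alpha>"
    and sym: "\<And>m. \<exists>n\<ge>m. \<forall>x\<in>A. x < n \<longrightarrow> n - x \<in> A"
    and gap: "\<And>m. \<exists>x\<ge>m. x \<in> A \<and> (\<exists>y\<in>A. x < y \<and> y \<le> x + c)"
  shows "\<exists>(A :: nat set) (a :: nat \<Rightarrow> nat).
           A \<subseteq> {1..} \<and> A = {a i | i. i \<ge> 1} \<and>
           (\<forall>i\<ge>1. a i < a (i + 1)) \<and>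
           has_density A \<alpha> \<and>
           liminf (\<lambda>n. ereal (real (a (n + 1)) / real (a n))) = 1 \<and>
           \<not> (\<exists>B. additive_complement_in_complement A B)"
proof -
  have inf: "infinite A"
    using gap unfolding infinite_nat_iff_unbounded_le by blast
  define a where "a = (\<lambda>i. enumerate A (i - 1))"
  have "A = {a i | i. i \<ge> 1}"
  proof (intro equalityI subsetI)
    fix x assume "x \<in> A"
    then obtain i where "x = a (Suc i)"
      using enumerate_Ex[OF inf] unfolding a_def by (metis diff_Suc_1)
    then show "x \<in> {a i | i. i \<ge> 1}" by auto
  qed (auto simp: a_def enumerate_in_set[OF inf])
  moreover have "\<forall>i\<ge>1. a i < a (i + 1)"
    using enumerate_mono_iff[OF inf] by (auto simp: a_def)
  moreover have "liminf (\<lambda>n. ereal (real (a (n + 1)) / real (a n))) = 1"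
    unfolding a_def by (rule liminf_ratio_enumerate[OF pos inf gap])
  moreover have "\<not> (\<exists>B. additive_complement_in_complement A B)"
    using no_complement_in_complement[OF sym] by blast
  ultimately show ?thesis using pos dens by blast
qed

section \<open>Positive density\<close>

text \<open>For 0 <= r < 1 this reads the binary digit of r at position v + 1 after the point, where
  v is the 2-adic valuation of n: each halving of n drops the leading digit of r. At r = 1 the
  remainder stays 1, so all digits are 1. The argument 0 gets its own clause because halving never
  leaves it.\<close>

function digit_at_valuation :: "real \<Rightarrow> nat \<Rightarrow> bool" where
  "digit_at_valuation r n \<longleftrightarrow>
     (if n = 0 then False else if odd n then r \<ge> 1/2
      else digit_at_valuation (2 * r - of_bool (r \<ge> 1/2)) (n div 2))"
  by auto
termination by (relation "measure snd") auto

declare digit_at_valuation.simps [simp del]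

lemma digit_at_valuation_0 [simp]: "\<not> digit_at_valuation r 0"
  by (simp add: digit_at_valuation.simps)

lemma digit_at_valuation_odd: "odd n \<Longrightarrow> digit_at_valuation r n \<longleftrightarrow> r \<ge> 1/2"
  by (subst digit_at_valuation.simps) (auto elim: oddE)

lemma digit_at_valuation_double:
  "digit_at_valuation r (2 * n) \<longleftrightarrow> digit_at_valuation (2 * r - of_bool (r \<ge> 1/2)) n"
  by (subst digit_at_valuation.simps) simp

text \<open>The numbers \<open>2 ^ k - x\<close>, \<open>2 ^ k + x\<close> and x have the same
  valuation, as halving all three shows. The minus sign gives the symmetry; both signs together give
  pairs at a fixed distance 2x.\<close>

lemma digit_at_valuation_power2:
  assumes "0 < x" "x < 2 ^ k"
  shows "digit_at_valuation r (2 ^ k - x) = digit_at_valuation r x"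
    and "digit_at_valuation r (2 ^ k + x) = digit_at_valuation r x"
proof -
  have "digit_at_valuation r (2 ^ k - x) = digit_at_valuation r x \<and>
        digit_at_valuation r (2 ^ k + x) = digit_at_valuation r x"
    using assms
  proof (induction k arbitrary: r x)
    case (Suc k)
    show ?case
    proof (cases "odd x")
      case True
      then show ?thesis using Suc.prems by (simp add: digit_at_valuation_odd)
    next
      case False
      then obtain z where z: "x = 2 * z" by blast
      have "2 ^ Suc k - x = 2 * (2 ^ k - z)" "2 ^ Suc k + x = 2 * (2 ^ k + z)"
        using z by simp_all
      moreover have "0 < z" "z < 2 ^ k" using Suc.prems z by simp_all
      ultimately show ?thesis using Suc.IH[of z] z digit_at_valuation_double by metis
    qed
  qed simp
  then show "digit_at_valuation r (2 ^ k - x) = digit_at_valuation r x"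
    and "digit_at_valuation r (2 ^ k + x) = digit_at_valuation r x" by auto
qed

text \<open>Odd numbers all read the first digit; halving carries the even ones to the numbers up to
  \<open>n div 2\<close>, which read the remaining digits.\<close>

lemma card_digit_at_valuation_rec:
  "card {x \<in> {1..n}. digit_at_valuation r x} =
     of_bool (r \<ge> 1/2) * ((n + 1) div 2) +
     card {x \<in> {1..n div 2}. digit_at_valuation (2 * r - of_bool (r \<ge> 1/2)) x}"
proof -
  let ?S = "{x \<in> {1..n}. digit_at_valuation r x}"
  let ?T = "{x \<in> {1..n div 2}. digit_at_valuation (2 * r - of_bool (r \<ge> 1/2)) x}"
  let ?O = "if r \<ge> 1/2 then (\<lambda>i. 2 * i + 1) ` {..<(n + 1) div 2} else {}"
  have "?S = ?O \<union> (*) 2 ` ?T"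
  proof (intro set_eqI)
    fix x
    show "x \<in> ?S \<longleftrightarrow> x \<in> ?O \<union> (*) 2 ` ?T"
    proof (cases "odd x")
      case True
      then obtain z where z: "x = 2 * z + 1" by (elim oddE)
      have "x \<notin> (*) 2 ` ?T" using True by auto
      moreover have "z < (n + 1) div 2 \<longleftrightarrow> 2 * z + 1 \<le> n" by linarith
      ultimately show ?thesis using True z by (auto simp: digit_at_valuation_odd)
    next
      case False
      then obtain z where z: "x = 2 * z" by blast
      have "x \<notin> ?O" using False by auto
      moreover have "z \<le> n div 2 \<longleftrightarrow> 2 * z \<le> n" by linarith
      ultimately show ?thesis using z by (auto simp: digit_at_valuation_double)
    qed
  qed
  moreover have "?O \<inter> (*) 2 ` ?T = {}"
    by (auto split: if_splits) presburger
  ultimately have "card ?S = card ?O + card ((*) 2 ` ?T)"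
    by (simp add: card_Un_disjoint)
  also have "card ?O = of_bool (r \<ge> 1/2) * ((n + 1) div 2)"
    by (simp add: card_image inj_on_def)
  also have "card ((*) 2 ` ?T) = card ?T"
    by (rule card_image) (simp add: inj_on_def)
  finally show ?thesis .
qed

text \<open>At most \<open>m\<close> halvings take n to 0, and rounding adds at most 1 to the error
  at each.\<close>

lemma card_digit_at_valuation_error:
  assumes "0 \<le> r" "r \<le> 1" "n < 2 ^ m"
  shows "\<bar>real (card {x \<in> {1..n}. digit_at_valuation r x}) - r * n\<bar> \<le> m"
  using assms
proof (induction m arbitrary: r n)
  case (Suc m)
  define b where "b = (of_bool (r \<ge> 1/2) :: real)"
  define s where "s = 2 * r - b"
  define C where "C = real (card {x \<in> {1..n div 2}. digit_at_valuation s x})"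
  have s: "0 \<le> s" "s \<le> 1" using Suc.prems by (auto simp: s_def b_def of_bool_def)
  have IH: "\<bar>C - s * real (n div 2)\<bar> \<le> m"
    unfolding C_def by (rule Suc.IH[OF s]) (use Suc.prems in auto)
  have "real (card {x \<in> {1..n}. digit_at_valuation r x}) = b * real ((n + 1) div 2) + C"
    using card_digit_at_valuation_rec[of n r] by (simp add: b_def s_def C_def)
  moreover have "r * n = b * (n / 2) + s * (n / 2)"
    by (simp add: s_def algebra_simps)
  \<comment> \<open>Since r = (b + s) / 2, the error splits into the rounding of the odd count, the
    error for \<open>n div 2\<close>, and the rounding of \<open>n div 2\<close> itself. Both
    rounding terms lie in [0, 1/2] and enter with opposite signs.\<close>
  ultimately have eq: "real (card {x \<in> {1..n}. digit_at_valuation r x}) - r * n =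
      b * (real ((n + 1) div 2) - n / 2) + (C - s * real (n div 2)) - s * (n / 2 - real (n div 2))"
    by (simp add: algebra_simps)
  have "0 \<le> real ((n + 1) div 2) - n / 2" "real ((n + 1) div 2) - n / 2 \<le> 1/2"
    by linarith+
  then have X: "0 \<le> b * (real ((n + 1) div 2) - n / 2)" "b * (real ((n + 1) div 2) - n / 2) \<le> 1/2"
    by (auto simp: b_def)
  have "0 \<le> n / 2 - real (n div 2)" "n / 2 - real (n div 2) \<le> 1/2"
    by linarith+
  then have Z: "0 \<le> s * (n / 2 - real (n div 2))" "s * (n / 2 - real (n div 2)) \<le> 1 * (1/2)"
    using s by (blast intro: mult_nonneg_nonneg, intro mult_mono) auto
  have "\<bar>x + y - z\<bar> \<le> Suc m"
    if "0 \<le> x" "x \<le> 1/2" "\<bar>y\<bar> \<le> m" "0 \<le> z" "z \<le> 1 * (1/2)" for x y z :: real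
    using that by simp
  from this[OF X IH Z] show ?case unfolding eq .
qed simp

text \<open>The counting error is at most the number of binary digits of n, hence
  logarithmic.\<close>

lemma has_density_digit_at_valuation:
  assumes "0 \<le> r" "r \<le> 1"
  shows "has_density {x. digit_at_valuation r x} r"
proof -
  let ?c = "\<lambda>n. real (card ({x. digit_at_valuation r x} \<inter> {1..n}))"
  have bound: "norm (?c n / n - r) \<le> (log 2 n + 1) / n" if n: "n \<ge> 1" for n
  proof -
    obtain k where k: "2 ^ k \<le> n" "n < 2 ^ (k + 1)"
      using ex_power_ivl1[of 2 n] n by auto
    have "{x. digit_at_valuation r x} \<inter> {1..n} = {x \<in> {1..n}. digit_at_valuation r x}" by auto
    then have "\<bar>?c n - r * n\<bar> \<le> real k + 1"
      using card_digit_at_valuation_error[OF assms k(2)] by simp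
    also have "real k \<le> log 2 n"
      using k(1) n by (simp add: le_log_of_power)
    finally have "\<bar>?c n - r * n\<bar> / n \<le> (log 2 n + 1) / n"
      by (simp add: divide_right_mono)
    moreover have "?c n / n - r = (?c n - r * n) / n" using n by (simp add: field_simps)
    ultimately show ?thesis by simp
  qed
  have "(\<lambda>n. (log 2 (real n) + 1) / real n) \<longlonglongrightarrow> 0" by real_asymp
  then have "(\<lambda>n. ?c n / n - r) \<longlonglongrightarrow> 0"
    by (rule tendsto_0_le[where K = 1], intro eventually_sequentiallyI[of 1])
      (rule order_trans[OF bound], simp_all)
  then show ?thesis
    unfolding has_density_def by (simp add: LIM_zero_iff)
qed

section \<open>Density zero\<close>

text \<open>The seeds are adjacent so that their mirror images are adjacent too. The factor 4
  between centres makes the copy of the part below \<open>3 * 4 ^ k\<close> land above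
  \<open>9 * 4 ^ k\<close>, clear of the original.\<close>

inductive_set reflections :: "nat set" where
  one: "1 \<in> reflections"
| two: "2 \<in> reflections"
| reflect: "x \<in> reflections \<Longrightarrow> x < 3 * 4 ^ k \<Longrightarrow> 3 * 4 ^ Suc k - x \<in> reflections"

lemma reflections_pos: "x \<in> reflections \<Longrightarrow> x \<ge> 1"
  by (cases rule: reflections.cases) auto

text \<open>Reflection number j lands strictly between \<open>9 * 4 ^ j\<close> and
  \<open>12 * 4 ^ j\<close>, so only j = k can reach this window; the seeds lie below all
  windows.\<close>

lemma reflections_below:
  assumes "x \<in> reflections" "x < 3 * 4 ^ Suc k" "x \<ge> 3 * 4 ^ k"
  obtains y where "y \<in> reflections" "y < 3 * 4 ^ k" "x = 3 * 4 ^ Suc k - y"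
  using assms(1)
proof cases
  case (reflect y j)
  have "\<not> j < k"
  proof
    assume "j < k"
    then have "(4::nat) ^ Suc j \<le> 4 ^ k" by (intro power_increasing) auto
    then show False using reflect assms(3) reflections_pos[of y] by simp
  qed
  moreover have "\<not> k < j"
  proof
    assume "k < j"
    then have "(4::nat) ^ Suc k \<le> 4 ^ j" by (intro power_increasing) auto
    then show False using reflect assms(2) by simp
  qed
  ultimately show ?thesis using that reflect by (metis linorder_neqE_nat)
next
  case one
  have "(1::nat) \<le> 4 ^ k" by simp
  then show ?thesis using assms(3) one by linarith
next
  case two
  have "(1::nat) \<le> 4 ^ k" by simp
  then show ?thesis using assms(3) two by linarith
qed

text \<open>The rule \<open>reflect\<close> only covers x below \<open>3 * 4 ^ k\<close>. A larger x
  is itself a mirror image, and reflecting it again returns its source.\<close>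

lemma reflections_symmetric:
  assumes "x \<in> reflections" "x < 3 * 4 ^ Suc k"
  shows "3 * 4 ^ Suc k - x \<in> reflections"
proof (cases "x < 3 * 4 ^ k")
  case True
  then show ?thesis using assms reflections.reflect by blast
next
  case False
  then obtain y where "y \<in> reflections" "y < 3 * 4 ^ k" "x = 3 * 4 ^ Suc k - y"
    using reflections_below assms by (metis not_less)
  then show ?thesis by simp
qed

text \<open>Each new window holds one mirrored copy of everything before it, so the count at most
  doubles while the bound quadruples.\<close>

lemma card_reflections_below: "card (reflections \<inter> {..<3 * 4 ^ k}) \<le> 2 * 2 ^ k"
proof (induction k)
  case 0
  have "reflections \<inter> {..<3} \<subseteq> {1, 2}" using reflections_pos by fastforce
  then have "card (reflections \<inter> {..<3}) \<le> card {1, 2 :: nat}" by (intro card_mono) auto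
  then show ?case by simp
next
  case (Suc k)
  let ?R = "reflections \<inter> {..<3 * 4 ^ k}"
  have "reflections \<inter> {..<3 * 4 ^ Suc k} \<subseteq> ?R \<union> (-) (3 * 4 ^ Suc k) ` ?R"
  proof
    fix x assume x: "x \<in> reflections \<inter> {..<3 * 4 ^ Suc k}"
    show "x \<in> ?R \<union> (-) (3 * 4 ^ Suc k) ` ?R"
    proof (cases "x < 3 * 4 ^ k")
      case False
      then obtain y where "y \<in> reflections" "y < 3 * 4 ^ k" "x = 3 * 4 ^ Suc k - y"
        using reflections_below[of x k] x by auto
      then show ?thesis by blast
    qed (use x in auto)
  qed
  then have "card (reflections \<inter> {..<3 * 4 ^ Suc k}) \<le> card (?R \<union> (-) (3 * 4 ^ Suc k) ` ?R)"
    by (intro card_mono) auto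
  also have "\<dots> \<le> card ?R + card ((-) (3 * 4 ^ Suc k) ` ?R)" by (rule card_Un_le)
  also have "\<dots> \<le> card ?R + card ?R" by (intro add_left_mono card_image_le) auto
  finally show ?case using Suc.IH by simp
qed

text \<open>Doubling against quadrupling means a count of at most 4 * sqrt n.\<close>

lemma has_density_reflections: "has_density reflections 0"
proof -
  let ?c = "\<lambda>n. real (card (reflections \<inter> {1..n}))"
  have bound: "norm (?c n / n) \<le> 4 * sqrt n / n" if n: "n \<ge> 1" for n
  proof -
    obtain k where k: "4 ^ k \<le> n" "n < 4 ^ (k + 1)"
      using ex_power_ivl1[of 4 n] n by auto
    have "card (reflections \<inter> {1..n}) \<le> card (reflections \<inter> {..<3 * 4 ^ (k + 1)})"
      using k(2) by (intro card_mono) auto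
    also have "\<dots> \<le> 2 * 2 ^ (k + 1)" by (rule card_reflections_below)
    finally have "?c n \<le> real (2 * 2 ^ (k + 1))" by (simp only: of_nat_le_iff)
    then have "?c n \<le> 4 * 2 ^ k" by simp
    also have "(2::real) ^ k \<le> sqrt n"
    proof (rule real_le_rsqrt)
      have "((2::real) ^ k)\<^sup>2 = real (4 ^ k)"
        by (simp add: power2_eq_square flip: power_mult_distrib)
      also have "\<dots> \<le> real n" using k(1) by (simp only: of_nat_le_iff)
      finally show "((2::real) ^ k)\<^sup>2 \<le> real n" .
    qed
    finally show ?thesis by (simp add: divide_right_mono)
  qed
  have "(\<lambda>n. 4 * sqrt (real n) / real n) \<longlonglongrightarrow> 0" by real_asymp
  then show ?thesis unfolding has_density_def
    by (rule tendsto_0_le[where K = 1], intro eventually_sequentiallyI[of 1])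
      (rule order_trans[OF bound], simp_all)
qed

theorem corollary2p1:
  fixes \<alpha> :: real
  assumes "0 \<le> \<alpha>" and "\<alpha> \<le> 1"
  shows "\<exists>(A :: nat set) (a :: nat \<Rightarrow> nat).
           A \<subseteq> {1..} \<and> A = {a i | i. i \<ge> 1} \<and>
           (\<forall>i\<ge>1. a i < a (i + 1)) \<and>
           has_density A \<alpha> \<and>
           liminf (\<lambda>n. ereal (real (a (n + 1)) / real (a n))) = 1 \<and>
           \<not> (\<exists>B. additive_complement_in_complement A B)"
proof (cases "\<alpha> = 0")
  case True
  show ?thesis
  proof (rule sequence_without_complement[where A = reflections and c = 1])
    show "reflections \<subseteq> {1..}" using reflections_pos by auto
    show "has_density reflections \<alpha>" using has_density_reflections True by simp
    fix m :: nat
    have m: "m < 4 ^ m" by (rule power_gt_expt) simp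
    then have "m \<le> 3 * 4 ^ Suc m" by simp
    then show "\<exists>n\<ge>m. \<forall>x\<in>reflections. x < n \<longrightarrow> n - x \<in> reflections"
      using reflections_symmetric by blast
    \<comment> \<open>Mirror images of the two seeds: consecutive elements, whence c = 1.\<close>
    have "3 * 4 ^ Suc m - 1 \<in> reflections" "3 * 4 ^ Suc m - 2 \<in> reflections"
      using reflections_symmetric[OF reflections.one, of m] reflections_symmetric[OF reflections.two, of m] m
      by auto
    then show "\<exists>x\<ge>m. x \<in> reflections \<and> (\<exists>y\<in>reflections. x < y \<and> y \<le> x + 1)"
      using m by (intro exI[of _ "3 * 4 ^ Suc m - 2"] conjI bexI[of _ "3 * 4 ^ Suc m - 1"]) auto
  qed
next
  case False
  let ?A = "{x. digit_at_valuation \<alpha> x}"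
  have dens: "has_density ?A \<alpha>" using has_density_digit_at_valuation assms by blast
  \<comment> \<open>An element z is needed as the seed of the close pairs; an empty set would have
    density 0.\<close>
  have "?A \<noteq> {}"
  proof
    assume "?A = {}"
    then have "(\<lambda>n. 0 :: real) \<longlonglongrightarrow> \<alpha>" using dens by (simp only: has_density_def) simp
    then show False using False LIMSEQ_unique tendsto_const by blast
  qed
  then obtain z where z: "z \<in> ?A" by blast
  have pos: "?A \<subseteq> {1..}" by (force intro: Suc_leI gr0I)
  have "z > 0" using z pos by auto
  show ?thesis
  proof (rule sequence_without_complement[OF pos dens, where c = "2 * z"])
    fix m :: nat
    have "m < 2 ^ m" by simp
    moreover have "2 ^ m - x \<in> ?A" if "x \<in> ?A" "x < 2 ^ m" for x
      using digit_at_valuation_power2(1)[of x m \<alpha>] that subsetD[OF pos, of x] by simp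
    ultimately show "\<exists>n\<ge>m. \<forall>x\<in>?A. x < n \<longrightarrow> n - x \<in> ?A"
      by (meson less_imp_le)
    \<comment> \<open>This exponent makes the power exceed z and also keeps
      \<open>2 ^ (m + z) - z\<close> above m. The pair around the power is \<open>2 * z\<close>
      apart.\<close>
    have k: "m + z < 2 ^ (m + z)" by (rule less_exp)
    then have "z < 2 ^ (m + z)" by linarith
    then have "2 ^ (m + z) - z \<in> ?A" "2 ^ (m + z) + z \<in> ?A"
      using digit_at_valuation_power2[of z "m + z" \<alpha>] z \<open>z > 0\<close> by auto
    then show "\<exists>x\<ge>m. x \<in> ?A \<and> (\<exists>y\<in>?A. x < y \<and> y \<le> x + 2 * z)"
      using k \<open>z > 0\<close>
      by (intro exI[of _ "2 ^ (m + z) - z"] conjI bexI[of _ "2 ^ (m + z) + z"]) (assumption | linarith)+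
  qed
qed

end
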